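(* Let $K$ be a field, $S=K[x_1,\ldots,x_n]$, let $I\subset S$ be a monomial ideal and $T=S/I$. Let $I_1,\ldots,I_s\subset S$ ($s\ge 1$) be monomial ideals and set $J_k=(I_k+I)/I\subset T$ for $k=1,\ldots,s$. Let $\mathbb{G}$ be the complex attached to $\{J_1,\ldots,J_s\}$. Then $$H_i(\mathbb{G})=\begin{cases} J, & \text{if } i=0,\\ 0, & \text{otherwise,}\end{cases}$$ where $J=\bigcap_{k=1}^sJ_k$.
   Context: Write $[s]=\{1,\dots,s\}$. For $U\subset[s]$ put $T_U=T/(\sum_{k\in U}J_k)$ (so $T_\emptyset=T$). The complex $\mathbb{G}$ attached to $\{J_1,\ldots,J_s\}$ is the (co)complex of $T$-modules $$0\to G_0\to G_1\to\cdots\to G_s\to 0,\qquad G_i=\bigoplus_{U\subset[s],\,|U|=i}T_U,$$ whose map $G_i\to G_{i+1}$ is given on components $T_U\to T_V$ ($|U|=i$, $|V|=i+1$) as follows: it is the zero map if $U\not\subset V$; if $V=U\cup\{k\}$, it is the canonical residue class map multiplied by $(-1)^\ell$, where $\ell$ is the number of elements $j\in U$ with $j<k$. $H_i(\mathbb{G})$ denotes the (co)homology of $\mathbb{G}$ at the position $G_i$; $H_0(\mathbb{G})$ is the kernel of $G_0=T\to G_1$. *)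

theory Defs
  imports "HOL-Algebra.QuotRing" "HOL-Algebra.Module" "HOL-Library.Poly_Mapping"
begin

section \<open>Polynomial rings and monomial ideals\<close>

text \<open>Exponent vectors are finitely supported functions on the variable indices, and polynomials
  are finitely supported functions on exponent vectors.\<close>

type_synonym 'k mpoly = "(nat \<Rightarrow>\<^sub>0 nat) \<Rightarrow>\<^sub>0 'k"

definition mpoly_ring :: "nat \<Rightarrow> ('k::field) mpoly ring" where
  "mpoly_ring n =
     \<lparr>carrier = {p. \<forall>m \<in> Poly_Mapping.keys p. Poly_Mapping.keys m \<subseteq> {1..n}},
      monoid.mult = (*), one = 1, ring.zero = 0, add = (+)\<rparr>"

definition monomials :: "nat \<Rightarrow> ('k::field) mpoly set" where
  "monomials n = {Poly_Mapping.single m 1 | m. Poly_Mapping.keys m \<subseteq> {1..n}}"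

definition monomial_ideal :: "nat \<Rightarrow> ('k::field) mpoly set \<Rightarrow> bool" where
  "monomial_ideal n I \<longleftrightarrow> (\<exists>M \<subseteq> monomials n. I = Idl\<^bsub>mpoly_ring n\<^esub> M)"


section \<open>Constructions with modules\<close>

text \<open>The type of modules extends that of rings; the fields \<open>mult\<close> and \<open>one\<close> play no role
  in the locale \<open>module\<close> and are left unspecified below.\<close>

definition regular_module :: "('a, 'm) ring_scheme \<Rightarrow> ('a, 'a) module" where
  "regular_module T =
     \<lparr>carrier = carrier T, monoid.mult = undefined, one = undefined,
      ring.zero = \<zero>\<^bsub>T\<^esub>, add = add T, smult = monoid.mult T\<rparr>"

definition quot_module :: "('a, 'b, 'm) module_scheme \<Rightarrow> 'b set \<Rightarrow> ('a, 'b set) module" where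
  "quot_module M N =
     \<lparr>carrier = a_rcosets\<^bsub>M\<^esub> N, monoid.mult = undefined, one = undefined,
      ring.zero = N, add = set_add M, smult = (\<lambda>a X. \<Union>x\<in>X. N +>\<^bsub>M\<^esub> (a \<odot>\<^bsub>M\<^esub> x))\<rparr>"

text \<open>Only used for finite index sets, where the direct sum is the product.\<close>

definition direct_sum :: "'i set \<Rightarrow> ('i \<Rightarrow> ('a, 'b, 'm) module_scheme) \<Rightarrow> ('a, 'i \<Rightarrow> 'b) module" where
  "direct_sum A M =
     \<lparr>carrier = (\<Pi>\<^sub>E i\<in>A. carrier (M i)), monoid.mult = undefined, one = undefined,
      ring.zero = (\<lambda>i\<in>A. \<zero>\<^bsub>M i\<^esub>), add = (\<lambda>f g. \<lambda>i\<in>A. f i \<oplus>\<^bsub>M i\<^esub> g i),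
      smult = (\<lambda>a f. \<lambda>i\<in>A. a \<odot>\<^bsub>M i\<^esub> f i)\<rparr>"


section \<open>The complex attached to a family of ideals\<close>

definition ideal_sum :: "('a, 'm) ring_scheme \<Rightarrow> (nat \<Rightarrow> 'a set) \<Rightarrow> nat set \<Rightarrow> 'a set" where
  "ideal_sum T J U = {finsum T f U | f. f \<in> (\<Pi> k\<in>U. J k)}"

definition T_mod :: "('a, 'm) ring_scheme \<Rightarrow> (nat \<Rightarrow> 'a set) \<Rightarrow> nat set \<Rightarrow> ('a, 'a set) module" where
  "T_mod T J U = quot_module (regular_module T) (ideal_sum T J U)"

definition subsets_of_card :: "nat \<Rightarrow> nat \<Rightarrow> nat set set" where
  "subsets_of_card s i = {U. U \<subseteq> {1..s} \<and> card U = i}"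

definition G_mod ::
  "('a, 'm) ring_scheme \<Rightarrow> (nat \<Rightarrow> 'a set) \<Rightarrow> nat \<Rightarrow> nat \<Rightarrow> ('a, nat set \<Rightarrow> 'a set) module" where
  "G_mod T J s i = direct_sum (subsets_of_card s i) (T_mod T J)"

text \<open>The residue class map from \<open>T_mod T J U\<close> to \<open>T_mod T J V\<close> for \<open>U \<subseteq> V\<close> sends the class
  of \<open>x\<close> to the class of \<open>x\<close>; the union below is over representatives of one class, all of which
  have the same class in the target.\<close>

definition res_map :: "('a, 'm) ring_scheme \<Rightarrow> (nat \<Rightarrow> 'a set) \<Rightarrow> nat set \<Rightarrow> 'a set \<Rightarrow> 'a set" where
  "res_map T J V X = (\<Union>x\<in>X. ideal_sum T J V +>\<^bsub>T\<^esub> x)"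

definition G_comp ::
  "('a, 'm) ring_scheme \<Rightarrow> (nat \<Rightarrow> 'a set) \<Rightarrow> nat set \<Rightarrow> nat set \<Rightarrow> 'a set \<Rightarrow> 'a set" where
  "G_comp T J U V X =
     (if U \<subseteq> V then
        (let k = the_elem (V - U); l = card {j \<in> U. j < k}
         in ((\<ominus>\<^bsub>T\<^esub> \<one>\<^bsub>T\<^esub>) [^]\<^bsub>T\<^esub> l) \<odot>\<^bsub>T_mod T J V\<^esub> res_map T J V X)
      else \<zero>\<^bsub>T_mod T J V\<^esub>)"

definition G_diff ::
  "('a, 'm) ring_scheme \<Rightarrow> (nat \<Rightarrow> 'a set) \<Rightarrow> nat \<Rightarrow> nat
     \<Rightarrow> (nat set \<Rightarrow> 'a set) \<Rightarrow> (nat set \<Rightarrow> 'a set)" where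
  "G_diff T J s i g =
     (\<lambda>V\<in>subsets_of_card s (Suc i).
        \<Oplus>\<^bsub>T_mod T J V\<^esub> U \<in> subsets_of_card s i. G_comp T J U V (g U))"

definition G_cocycles ::
  "('a, 'm) ring_scheme \<Rightarrow> (nat \<Rightarrow> 'a set) \<Rightarrow> nat \<Rightarrow> nat \<Rightarrow> (nat set \<Rightarrow> 'a set) set" where
  "G_cocycles T J s i = a_kernel (G_mod T J s i) (G_mod T J s (Suc i)) (G_diff T J s i)"

text \<open>\<open>H_zero\<close> is the kernel of the first map itself; in positive degrees cohomology is the
  quotient of the submodule of cocycles by that of coboundaries. For \<open>i > s\<close> the module
  \<open>G_mod T J s i\<close> is an empty direct sum, hence zero, so the last map of the complex is the
  map to 0.\<close>

definition H_zero ::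
  "('a, 'm) ring_scheme \<Rightarrow> (nat \<Rightarrow> 'a set) \<Rightarrow> nat \<Rightarrow> ('a, nat set \<Rightarrow> 'a set) module" where
  "H_zero T J s = (G_mod T J s 0)\<lparr>carrier := G_cocycles T J s 0\<rparr>"

definition H_pos ::
  "('a, 'm) ring_scheme \<Rightarrow> (nat \<Rightarrow> 'a set) \<Rightarrow> nat \<Rightarrow> nat \<Rightarrow> ('a, (nat set \<Rightarrow> 'a set) set) module" where
  "H_pos T J s i =
     quot_module ((G_mod T J s i)\<lparr>carrier := G_cocycles T J s i\<rparr>)
       (G_diff T J s (i - 1) ` carrier (G_mod T J s (i - 1)))"

text \<open>\<open>T\<close> and the single summand \<open>T_mod T J {}\<close> of \<open>G_mod T J s 0\<close> are usually identified.
  Elements of the latter are cosets of the zero ideal, so the identification is a map here.\<close>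

definition G_zero_embed ::
  "('a, 'm) ring_scheme \<Rightarrow> (nat \<Rightarrow> 'a set) \<Rightarrow> 'a \<Rightarrow> (nat set \<Rightarrow> 'a set)" where
  "G_zero_embed T J x = (\<lambda>U\<in>{{}}. ideal_sum T J {} +>\<^bsub>T\<^esub> x)"

lemma subsets_of_card_0: "subsets_of_card s 0 = {{}}"
proof -
  have "U = {}" if "U \<subseteq> {1..s}" "card U = 0" for U
    using finite_subset[OF that(1) finite_atLeastAtMost] that(2) by (simp only: card_0_eq)
  then show ?thesis
    unfolding subsets_of_card_def by (intro equalityI subsetI) auto
qed

lemma subsets_of_card_gt:
  assumes "s < i"
  shows "subsets_of_card s i = {}"
proof -
  have "card U \<le> s" if "U \<subseteq> {1..s}" for U
    using card_mono[OF _ that] by simp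
  with assms have "U \<notin> subsets_of_card s i" for U
    unfolding subsets_of_card_def using linorder_not_less by blast
  then show ?thesis by blast
qed

lemma G_zero_embed_bij:
  assumes "ring T"
  shows "bij_betw (G_zero_embed T J) (carrier T) (carrier (G_mod T J s 0))"
proof -
  interpret ring T by fact
  have sum0: "ideal_sum T J {} = {\<zero>\<^bsub>T\<^esub>}"
    by (simp add: ideal_sum_def)
  have coset: "{\<zero>\<^bsub>T\<^esub>} +>\<^bsub>T\<^esub> x = {x}" if "x \<in> carrier T" for x
    using that by (simp add: a_r_coset_def')
  have emb: "G_zero_embed T J x = (\<lambda>U\<in>{{}}. {x})" if "x \<in> carrier T" for x
    by (simp only: G_zero_embed_def sum0 coset[OF that])
  have "carrier (T_mod T J {}) = (\<Union>x\<in>carrier T. {{\<zero>\<^bsub>T\<^esub>} +>\<^bsub>T\<^esub> x})"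
    by (simp add: T_mod_def quot_module_def regular_module_def sum0 A_RCOSETS_def'
        a_r_coset_def')
  also have "\<dots> = (\<lambda>x. {x}) ` carrier T"
    using coset by blast
  finally have car0: "carrier (T_mod T J {}) = (\<lambda>x. {x}) ` carrier T" .
  have car: "carrier (G_mod T J s 0) = (\<Pi>\<^sub>E U\<in>{{}}. carrier (T_mod T J U))"
    by (simp add: G_mod_def direct_sum_def subsets_of_card_0)
  show ?thesis
  proof (rule bij_betw_imageI)
    show "inj_on (G_zero_embed T J) (carrier T)"
    proof (rule inj_onI)
      fix x y assume x: "x \<in> carrier T" and y: "y \<in> carrier T"
        and "G_zero_embed T J x = G_zero_embed T J y"
      then have "(\<lambda>U\<in>{{} :: nat set}. {x}) = (\<lambda>U\<in>{{}}. {y})"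
        using x y by (simp only: emb)
      from fun_cong[OF this, of "{}"] show "x = y" by simp
    qed
    show "G_zero_embed T J ` carrier T = carrier (G_mod T J s 0)"
    proof (intro equalityI subsetI)
      fix g assume "g \<in> G_zero_embed T J ` carrier T"
      then obtain x where x: "x \<in> carrier T" "g = (\<lambda>U\<in>{{}}. {x})"
        using emb by blast
      show "g \<in> carrier (G_mod T J s 0)"
        unfolding x(2) car restrict_PiE_iff using x(1) by (simp add: car0)
    next
      fix g assume "g \<in> carrier (G_mod T J s 0)"
      then have "g {} \<in> carrier (T_mod T J {})" and ext: "g \<in> extensional {{}}"
        by (auto simp: car PiE_def)
      then obtain x where x: "x \<in> carrier T" "g {} = {x}"
        unfolding car0 by blast
      have "g = (\<lambda>U\<in>{{}}. {x})"
        by (rule extensionalityI[OF ext restrict_extensional]) (simp add: x)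
      then have "g = G_zero_embed T J x"
        by (simp only: emb[OF x(1)])
      then show "g \<in> G_zero_embed T J ` carrier T"
        using x(1) by (rule image_eqI)
    qed
  qed
qed

end

theory Submission
  imports Defs "HOL-Algebra.UnivPoly"
begin

text \<open>
  The idea: ideals spanned by monomials split coefficient by coefficient. Write \<open>m \<in> I\<close> if the
  monomial with exponent vector \<open>m\<close> lies in \<open>I\<close>, and choose polynomials representing the
  components of a cochain. A polynomial vanishes in \<open>T_U\<close> iff each exponent \<open>m\<close> occurring in it
  satisfies \<open>m \<in> I\<close> or \<open>m \<in> I_k\<close> for some \<open>k \<in> U\<close> (lemma
  \<open>proj_mem_ideal_sum_iff\<close>). Hence, for a fixed exponent \<open>m\<close> not in \<open>I\<close>, only the index
  sets \<open>U\<close> contained in \<open>A m = {k. m \<notin> I_k}\<close> matter, and on those the coefficients at \<open>m\<close> form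
  the augmented cochain complex of the full simplex on the vertex set \<open>A m\<close>. This complex is
  contractible when \<open>A m\<close> is nonempty: with \<open>a = Min (A m)\<close>, the coning operator sending a cochain
  \<open>c\<close> to \<open>U \<mapsto> c (insert a U)\<close> for \<open>a \<notin> U\<close>, and to \<open>0\<close> for \<open>a \<in> U\<close>, is a contracting
  homotopy (lemma \<open>simplex_contraction\<close>). In positive degrees the index sets are nonempty, so
  \<open>A m\<close> is nonempty whenever the coefficient at \<open>m\<close> matters at all.

  The vertex \<open>a\<close> depends on \<open>m\<close>, but only finitely many exponents occur in the representatives of a
  cochain, so the values of the coning operator at the various \<open>m\<close> are again the coefficients of
  polynomials (lemma \<open>homotopy_polynomial\<close>). These polynomials represent a cochain whose coboundary
  is the given cocycle, which proves the vanishing in positive degrees. In degree \<open>0\<close> a cocycle is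
  an \<open>x\<close> in \<open>T\<close> whose class in every \<open>T/J_k\<close> vanishes, for any family of ideals.

  The rest is translation. For an arbitrary commutative ring with a family of ideals, cochains,
  their differentials and the two cohomology modules are expressed by representatives in the ring
  (locale \<open>ideal_family\<close>), which reduces the vanishing of \<open>H_i\<close> to a statement about
  representatives (lemma \<open>H_pos_trivial\<close>).
\<close>

section \<open>The complex in terms of representatives\<close>

lemma (in cring) ideal_sum_ideal:
  assumes "finite U" and "\<And>k. k \<in> U \<Longrightarrow> ideal (J k) R"
  shows "ideal (ideal_sum R J U) R"
  using assms
proof (induction U rule: finite_induct)
  case empty
  have "ideal_sum R J {} = {\<zero>}" by (simp add: ideal_sum_def)
  then show ?case by (simp add: zeroideal)
next
  case (insert k U)
  interpret Jk: ideal "J k" R by (rule insert.prems) simp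
  have sub: "J j \<subseteq> carrier R" if "j \<in> insert k U" for j
    using insert.prems[OF that] by (simp add: additive_subgroup.a_subset ideal.axioms(1))
  have "ideal_sum R J (insert k U) = set_add R (J k) (ideal_sum R J U)"
  proof (intro equalityI subsetI)
    fix x assume "x \<in> ideal_sum R J (insert k U)"
    then obtain f where f: "f \<in> (\<Pi> j\<in>insert k U. J j)" "x = finsum R f (insert k U)"
      by (auto simp: ideal_sum_def)
    have "x = f k \<oplus> finsum R f U"
      unfolding f(2) using f(1) sub insert.hyps by (intro finsum_insert) (auto simp: Pi_iff)
    moreover have "finsum R f U \<in> ideal_sum R J U"
      using f(1) by (auto simp: ideal_sum_def Pi_iff)
    ultimately show "x \<in> set_add R (J k) (ideal_sum R J U)"
      using f(1) by (auto simp: set_add_def' Pi_iff)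
  next
    fix x assume "x \<in> set_add R (J k) (ideal_sum R J U)"
    then obtain a f where f: "a \<in> J k" "f \<in> (\<Pi> j\<in>U. J j)" "x = a \<oplus> finsum R f U"
      by (auto simp: set_add_def' ideal_sum_def)
    have "finsum R (f(k := a)) (insert k U) = (f(k := a)) k \<oplus> finsum R (f(k := a)) U"
      using f sub insert.hyps by (intro finsum_insert) (auto simp: Pi_iff)
    also have "finsum R (f(k := a)) U = finsum R f U"
      using f sub insert.hyps by (intro finsum_cong') (auto simp: Pi_iff)
    finally have "x = finsum R (f(k := a)) (insert k U)" by (metis f(3) fun_upd_same)
    moreover have "f(k := a) \<in> (\<Pi> j\<in>insert k U. J j)" using f by (auto simp: Pi_iff)
    ultimately show "x \<in> ideal_sum R J (insert k U)" unfolding ideal_sum_def by blast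
  qed
  then show ?case using insert by (simp add: add_ideals)
qed

lemma T_mod_simps:
  "carrier (T_mod T J U) = a_rcosets\<^bsub>T\<^esub> (ideal_sum T J U)"
  "\<zero>\<^bsub>T_mod T J U\<^esub> = ideal_sum T J U"
  "add (T_mod T J U) = set_add T"
  "a \<odot>\<^bsub>T_mod T J U\<^esub> X = (\<Union>x\<in>X. ideal_sum T J U +>\<^bsub>T\<^esub> (a \<otimes>\<^bsub>T\<^esub> x))"
  by (simp_all add: T_mod_def quot_module_def regular_module_def A_RCOSETS_def' a_r_coset_def'
      set_add_def' fun_eq_iff)

text \<open>Sums in \<open>T_U\<close> may be computed in the quotient ring, where the residue class map is known to be
  a ring homomorphism. The two structures have the same carrier, addition and zero, but their additive
  monoids are records of different types, so the equality can only be stated for the sum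
  operators.\<close>

lemma finsum_T_mod: "finsum (T_mod T J U) = finsum (T Quot ideal_sum T J U)"
proof -
  have "finprod (add_monoid (T_mod T J U)) = finprod (add_monoid (T Quot ideal_sum T J U))"
    by (simp add: T_mod_simps FactRing_def finprod_def fun_eq_iff)
  then show ?thesis by (simp add: finsum_def)
qed

lemma G_mod_simps:
  "carrier (G_mod T J s i) = (\<Pi>\<^sub>E U\<in>subsets_of_card s i. a_rcosets\<^bsub>T\<^esub> (ideal_sum T J U))"
  "\<zero>\<^bsub>G_mod T J s i\<^esub> = (\<lambda>U\<in>subsets_of_card s i. ideal_sum T J U)"
  "g \<oplus>\<^bsub>G_mod T J s i\<^esub> h = (\<lambda>U\<in>subsets_of_card s i. g U <+>\<^bsub>T\<^esub> h U)"
  by (simp_all add: G_mod_def direct_sum_def T_mod_simps)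

lemma finite_subsets_of_card [simp]: "finite (subsets_of_card s i)"
  by (simp add: subsets_of_card_def)

text \<open>The scalar in \<open>T\<close> by which the component \<open>T_U \<rightarrow> T_V\<close> of the differential multiplies a
  representative. It is meaningful for \<open>V = insert k U\<close>, where \<open>the_elem (V - U)\<close> is \<open>k\<close>.\<close>

definition incidence :: "('a, 'm) ring_scheme \<Rightarrow> nat set \<Rightarrow> nat set \<Rightarrow> 'a" where
  "incidence T U V =
     (if U \<subseteq> V then (\<ominus>\<^bsub>T\<^esub> \<one>\<^bsub>T\<^esub>) [^]\<^bsub>T\<^esub> card {j \<in> U. j < the_elem (V - U)} else \<zero>\<^bsub>T\<^esub>)"

text \<open>The differential lifted to families of ring elements, before passing to residue classes.\<close>

definition cobound ::
  "('a, 'm) ring_scheme \<Rightarrow> nat \<Rightarrow> nat \<Rightarrow> (nat set \<Rightarrow> 'a) \<Rightarrow> nat set \<Rightarrow> 'a" where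
  "cobound T s i x V = (\<Oplus>\<^bsub>T\<^esub> U \<in> subsets_of_card s i. incidence T U V \<otimes>\<^bsub>T\<^esub> x U)"

lemma (in cring) incidence_closed [simp]: "incidence R U V \<in> carrier R"
  by (simp add: incidence_def)

lemma (in cring) cobound_closed [simp]:
  assumes "x \<in> subsets_of_card s i \<rightarrow> carrier R"
  shows "cobound R s i x V \<in> carrier R"
  unfolding cobound_def using assms by (intro finsum_closed) auto

lemma (in cring) cobound_add:
  assumes "x \<in> subsets_of_card s i \<rightarrow> carrier R" "y \<in> subsets_of_card s i \<rightarrow> carrier R"
  shows "cobound R s i (\<lambda>U. x U \<oplus> y U) V = cobound R s i x V \<oplus> cobound R s i y V"
proof -
  have "cobound R s i x V \<oplus> cobound R s i y V
     = (\<Oplus> U\<in>subsets_of_card s i. incidence R U V \<otimes> x U \<oplus> incidence R U V \<otimes> y U)"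
    unfolding cobound_def using assms by (intro finsum_addf[symmetric]) (auto simp: Pi_iff)
  also have "\<dots> = cobound R s i (\<lambda>U. x U \<oplus> y U) V"
    unfolding cobound_def using assms by (intro finsum_cong') (auto simp: Pi_iff r_distr)
  finally show ?thesis ..
qed

lemma (in cring) cobound_cong:
  assumes "\<And>U. U \<in> subsets_of_card s i \<Longrightarrow> x U = y U"
    and "y \<in> subsets_of_card s i \<rightarrow> carrier R"
  shows "cobound R s i x V = cobound R s i y V"
  unfolding cobound_def using assms by (intro finsum_cong') (auto simp: Pi_iff)

locale ideal_family = cring T for T (structure) +
  fixes J :: "nat \<Rightarrow> 'a set" and s :: nat
  assumes J_ideal: "k \<in> {1..s} \<Longrightarrow> ideal (J k) T"
begin

abbreviation cls :: "nat set \<Rightarrow> 'a \<Rightarrow> 'a set" where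
  "cls U x \<equiv> ideal_sum T J U +> x"

definition coset_family :: "nat \<Rightarrow> (nat set \<Rightarrow> 'a) \<Rightarrow> nat set \<Rightarrow> 'a set" where
  "coset_family i x = (\<lambda>U\<in>subsets_of_card s i. cls U (x U))"

lemma ideal_sum_is_ideal:
  assumes "U \<subseteq> {1..s}"
  shows "ideal (ideal_sum T J U) T"
  using assms J_ideal by (intro ideal_sum_ideal) (auto intro: finite_subset)

text \<open>An element of the smaller sum is extended by \<open>0\<close> on the additional indices.\<close>

lemma ideal_sum_mono:
  assumes "U \<subseteq> V" "V \<subseteq> {1..s}"
  shows "ideal_sum T J U \<subseteq> ideal_sum T J V"
proof
  fix x assume "x \<in> ideal_sum T J U"
  then obtain f where f: "f \<in> (\<Pi> k\<in>U. J k)" "x = finsum T f U"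
    by (auto simp: ideal_sum_def)
  define g where "g = (\<lambda>k. if k \<in> U then f k else \<zero>)"
  have fin: "finite V" using assms(2) by (rule finite_subset) simp
  have add: "additive_subgroup (J k) T" if "k \<in> V" for k
    using J_ideal[of k] that assms(2) ideal.axioms(1) by blast
  have g: "g \<in> (\<Pi> k\<in>V. J k)"
    using f(1) add by (auto simp: g_def Pi_iff additive_subgroup.zero_closed)
  then have gT: "g \<in> V \<rightarrow> carrier T"
    using add by (auto simp: Pi_iff dest: additive_subgroup.a_subset)
  have "x = finsum T g U"
    unfolding f(2)
  proof (rule finsum_cong')
    show "g \<in> U \<rightarrow> carrier T" using gT assms(1) by blast
  qed (auto simp: g_def)
  also have "\<dots> = finsum T g V"
    using gT assms(1) fin by (intro add.finprod_mono_neutral_cong_left) (auto simp: g_def Pi_iff)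
  finally show "x \<in> ideal_sum T J V" using g by (auto simp: ideal_sum_def)
qed

lemma cls_eq:
  assumes "V \<subseteq> {1..s}" "x \<in> carrier T" "h \<in> ideal_sum T J V"
  shows "cls V (h \<oplus> x) = cls V x"
proof -
  interpret V: ideal "ideal_sum T J V" T by (rule ideal_sum_is_ideal[OF assms(1)])
  have "h \<oplus> x \<in> cls V x" using assms(3) by (auto simp: a_r_coset_def')
  then show ?thesis using assms(2) V.a_repr_independence' by metis
qed

lemma cls_eq_zero_iff:
  assumes "V \<subseteq> {1..s}" "x \<in> carrier T"
  shows "cls V x = ideal_sum T J V \<longleftrightarrow> x \<in> ideal_sum T J V"
proof -
  interpret V: ideal "ideal_sum T J V" T by (rule ideal_sum_is_ideal[OF assms(1)])
  show ?thesis using V.a_rcos_const V.a_rcos_self[OF assms(2)] by auto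
qed

lemma cls_add:
  assumes "V \<subseteq> {1..s}" "x \<in> carrier T" "y \<in> carrier T"
  shows "set_add T (cls V x) (cls V y) = cls V (x \<oplus> y)"
proof -
  interpret V: ideal "ideal_sum T J V" T by (rule ideal_sum_is_ideal[OF assms(1)])
  show ?thesis by (rule V.a_rcos_sum[OF assms(2,3)])
qed

text \<open>Both the residue class map and the scalar multiplication in \<open>T_V\<close> are unions over all
  representatives. Such a union is a single coset since all representatives contribute the same one.\<close>

lemma cls_UN:
  assumes "U \<subseteq> V" "V \<subseteq> {1..s}" "x \<in> carrier T" "a \<in> carrier T"
  shows "(\<Union>y\<in>cls U x. cls V (a \<otimes> y)) = cls V (a \<otimes> x)"
proof -
  interpret U: ideal "ideal_sum T J U" T using assms by (intro ideal_sum_is_ideal) auto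
  interpret V: ideal "ideal_sum T J V" T by (rule ideal_sum_is_ideal[OF assms(2)])
  have "cls V (a \<otimes> y) = cls V (a \<otimes> x)" if "y \<in> cls U x" for y
  proof -
    from that obtain h where h: "h \<in> ideal_sum T J U" "y = h \<oplus> x"
      by (auto simp: a_r_coset_def')
    have "h \<in> ideal_sum T J V" using ideal_sum_mono[OF assms(1,2)] h(1) by (rule subsetD)
    then have "a \<otimes> h \<in> ideal_sum T J V" using assms(4) by (rule V.I_l_closed)
    moreover have "a \<otimes> y = a \<otimes> h \<oplus> a \<otimes> x"
      using h assms U.a_subset by (auto simp: r_distr)
    ultimately show ?thesis using assms by (simp add: cls_eq)
  qed
  moreover have "cls U x \<noteq> {}" using U.a_rcos_self[OF assms(3)] by blast
  ultimately show ?thesis by auto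
qed

lemma G_comp_cls:
  assumes "V \<subseteq> {1..s}" "x \<in> carrier T"
  shows "G_comp T J U V (cls U x) = cls V (incidence T U V \<otimes> x)"
proof (cases "U \<subseteq> V")
  case True
  have cl: "y \<in> carrier T" if "y \<in> cls U x" for y
    using additive_subgroup.a_subset[OF ideal.axioms(1)[OF ideal_sum_is_ideal, of U]] True assms that
    by (auto simp: a_r_coset_def')
  have "res_map T J V (cls U x) = (\<Union>y\<in>cls U x. cls V (\<one> \<otimes> y))"
    unfolding res_map_def using cl by auto
  also have "\<dots> = cls V x" using cls_UN[OF True assms(1,2), of \<one>] assms by simp
  finally have res: "res_map T J V (cls U x) = cls V x" .
  have "G_comp T J U V (cls U x) = (\<Union>y\<in>cls V x. cls V (incidence T U V \<otimes> y))"
    using True by (simp only: G_comp_def Let_def res T_mod_simps incidence_def if_True)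
  also have "\<dots> = cls V (incidence T U V \<otimes> x)"
    using assms by (intro cls_UN) auto
  finally show ?thesis .
next
  case False
  interpret V: ideal "ideal_sum T J V" T by (rule ideal_sum_is_ideal[OF assms(1)])
  have "incidence T U V \<otimes> x \<in> ideal_sum T J V"
    using False assms(2) by (simp add: incidence_def)
  then have "cls V (incidence T U V \<otimes> x) = ideal_sum T J V" by (rule V.a_rcos_const)
  then show ?thesis using False by (simp only: G_comp_def T_mod_simps if_False)
qed

lemma G_diff_coset_family:
  assumes "x \<in> subsets_of_card s i \<rightarrow> carrier T"
  shows "G_diff T J s i (coset_family i x) = coset_family (Suc i) (cobound T s i x)"
proof -
  have eq: "(\<Oplus>\<^bsub>T_mod T J V\<^esub> U \<in> subsets_of_card s i. G_comp T J U V (coset_family i x U))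
      = cls V (cobound T s i x V)" if "V \<in> subsets_of_card s (Suc i)" for V
  proof -
    have V: "V \<subseteq> {1..s}" using that by (simp add: subsets_of_card_def)
    interpret V: ideal "ideal_sum T J V" T by (rule ideal_sum_is_ideal[OF V])
    interpret hom: ring_hom_cring T "T Quot ideal_sum T J V" "(+>) (ideal_sum T J V)"
      by (rule V.rcos_ring_hom_cring) (rule is_cring)
    have "(\<Oplus>\<^bsub>T Quot ideal_sum T J V\<^esub> U \<in> subsets_of_card s i. G_comp T J U V (coset_family i x U))
       = (\<Oplus>\<^bsub>T Quot ideal_sum T J V\<^esub> U \<in> subsets_of_card s i. cls V (incidence T U V \<otimes> x U))"
      using assms V by (intro hom.S.finsum_cong') (auto simp: coset_family_def G_comp_cls Pi_iff)
    also have "\<dots> = cls V (cobound T s i x V)"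
      unfolding cobound_def using assms by (subst hom.hom_finsum) (auto simp: o_def)
    finally show ?thesis by (simp add: finsum_T_mod)
  qed
  show ?thesis
    unfolding G_diff_def coset_family_def[of "Suc i"] by (rule restrict_ext) (rule eq)
qed

lemma carrier_G_mod:
  "carrier (G_mod T J s i) = coset_family i ` (subsets_of_card s i \<rightarrow> carrier T)"
proof (intro equalityI subsetI)
  fix g assume g: "g \<in> carrier (G_mod T J s i)"
  then have "\<forall>U\<in>subsets_of_card s i. \<exists>x\<in>carrier T. g U = cls U x"
    by (auto simp: G_mod_simps A_RCOSETS_def' PiE_iff)
  then obtain x where x: "\<forall>U\<in>subsets_of_card s i. x U \<in> carrier T \<and> g U = cls U (x U)"
    by (metis (no_types))
  moreover have "g = coset_family i x"
    using g x by (auto simp: G_mod_simps coset_family_def PiE_iff extensional_def fun_eq_iff)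
  ultimately show "g \<in> coset_family i ` (subsets_of_card s i \<rightarrow> carrier T)" by auto
next
  fix g assume "g \<in> coset_family i ` (subsets_of_card s i \<rightarrow> carrier T)"
  then obtain x where x: "x \<in> subsets_of_card s i \<rightarrow> carrier T" "g = coset_family i x" by blast
  then have "cls U (x U) \<in> a_rcosets (ideal_sum T J U)" if "U \<in> subsets_of_card s i" for U
    using that by (auto simp: A_RCOSETS_def')
  then show "g \<in> carrier (G_mod T J s i)"
    by (simp add: x(2) G_mod_simps coset_family_def restrict_PiE_iff)
qed

lemma coset_family_eq_zero_iff:
  assumes "x \<in> subsets_of_card s i \<rightarrow> carrier T"
  shows "coset_family i x = \<zero>\<^bsub>G_mod T J s i\<^esub> \<longleftrightarrow> (\<forall>V\<in>subsets_of_card s i. x V \<in> ideal_sum T J V)"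
proof -
  have "coset_family i x = \<zero>\<^bsub>G_mod T J s i\<^esub> \<longleftrightarrow>
     (\<forall>V\<in>subsets_of_card s i. cls V (x V) = ideal_sum T J V)"
    by (auto simp: coset_family_def G_mod_simps fun_eq_iff restrict_def)
  also have "\<dots> \<longleftrightarrow> (\<forall>V\<in>subsets_of_card s i. x V \<in> ideal_sum T J V)"
    using assms by (intro ball_cong refl cls_eq_zero_iff) (auto simp: subsets_of_card_def)
  finally show ?thesis .
qed

lemma G_cocycles_eq:
  "G_cocycles T J s i = coset_family i ` {x \<in> subsets_of_card s i \<rightarrow> carrier T.
     \<forall>V\<in>subsets_of_card s (Suc i). cobound T s i x V \<in> ideal_sum T J V}"
proof -
  have "G_cocycles T J s i = coset_family i ` {x \<in> subsets_of_card s i \<rightarrow> carrier T.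
      G_diff T J s i (coset_family i x) = \<zero>\<^bsub>G_mod T J s (Suc i)\<^esub>}"
    unfolding G_cocycles_def a_kernel_def' carrier_G_mod by (rule Compr_image_eq)
  also have "\<dots> = coset_family i ` {x \<in> subsets_of_card s i \<rightarrow> carrier T.
      \<forall>V\<in>subsets_of_card s (Suc i). cobound T s i x V \<in> ideal_sum T J V}"
  proof (intro arg_cong[of _ _ "image _"] Collect_cong conj_cong refl)
    fix x assume x: "x \<in> subsets_of_card s i \<rightarrow> carrier T"
    then have "cobound T s i x \<in> subsets_of_card s (Suc i) \<rightarrow> carrier T" by simp
    with x show "G_diff T J s i (coset_family i x) = \<zero>\<^bsub>G_mod T J s (Suc i)\<^esub> \<longleftrightarrow>
        (\<forall>V\<in>subsets_of_card s (Suc i). cobound T s i x V \<in> ideal_sum T J V)"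
      by (simp only: G_diff_coset_family coset_family_eq_zero_iff)
  qed
  finally show ?thesis .
qed

lemma coset_family_add:
  assumes "x \<in> subsets_of_card s i \<rightarrow> carrier T" "y \<in> subsets_of_card s i \<rightarrow> carrier T"
  shows "coset_family i x \<oplus>\<^bsub>G_mod T J s i\<^esub> coset_family i y = coset_family i (\<lambda>U. x U \<oplus> y U)"
  unfolding G_mod_simps coset_family_def
proof (rule restrict_ext)
  fix U assume U: "U \<in> subsets_of_card s i"
  then have "U \<subseteq> {1..s}" "x U \<in> carrier T" "y U \<in> carrier T"
    using assms by (auto simp: subsets_of_card_def)
  with U show "set_add T ((\<lambda>U\<in>subsets_of_card s i. cls U (x U)) U)
      ((\<lambda>U\<in>subsets_of_card s i. cls U (y U)) U) = cls U (x U \<oplus> y U)"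
    by (simp add: cls_add)
qed

text \<open>It suffices to lift cocycles to coboundaries on representatives: cochains are families of
  cosets, so equality only has to hold modulo the ideals. The quotient module is a set of cosets
  \<open>B + z\<close> of the coboundaries \<open>B\<close>, with \<open>z\<close> a cocycle; once all cocycles lie in \<open>B\<close>, each of these is \<open>B\<close>
  because \<open>B\<close> is closed under sums and differences.\<close>

lemma H_pos_trivial:
  assumes exact: "\<And>x. \<lbrakk>x \<in> subsets_of_card s (Suc i) \<rightarrow> carrier T;
        \<forall>W\<in>subsets_of_card s (Suc (Suc i)). cobound T s (Suc i) x W \<in> ideal_sum T J W\<rbrakk>
      \<Longrightarrow> \<exists>y \<in> subsets_of_card s i \<rightarrow> carrier T.
            \<forall>V\<in>subsets_of_card s (Suc i). x V \<ominus> cobound T s i y V \<in> ideal_sum T J V"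
  shows "carrier (H_pos T J s (Suc i)) = {\<zero>\<^bsub>H_pos T J s (Suc i)\<^esub>}"
proof -
  let ?A = "subsets_of_card s i \<rightarrow> carrier T"
  let ?B = "(\<lambda>y. coset_family (Suc i) (cobound T s i y)) ` ?A"
  let ?Z = "G_cocycles T J s (Suc i)"
  let ?add = "add (G_mod T J s (Suc i))"
  have B: "G_diff T J s i ` carrier (G_mod T J s i) = ?B"
    by (auto simp: carrier_G_mod image_image G_diff_coset_family intro!: image_cong)
  have ZB: "?Z \<subseteq> ?B"
  proof
    fix z assume "z \<in> ?Z"
    then obtain x where x: "x \<in> subsets_of_card s (Suc i) \<rightarrow> carrier T" "z = coset_family (Suc i) x"
        "\<forall>W\<in>subsets_of_card s (Suc (Suc i)). cobound T s (Suc i) x W \<in> ideal_sum T J W"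
      by (auto simp: G_cocycles_eq)
    from exact[OF x(1,3)] obtain y where y: "y \<in> ?A"
        "\<forall>V\<in>subsets_of_card s (Suc i). x V \<ominus> cobound T s i y V \<in> ideal_sum T J V" by blast
    have "cls V (x V) = cls V (cobound T s i y V)" if "V \<in> subsets_of_card s (Suc i)" for V
    proof -
      have V: "V \<subseteq> {1..s}" using that by (simp add: subsets_of_card_def)
      have "x V \<in> carrier T" using x(1) that by auto
      then have "(x V \<ominus> cobound T s i y V) \<oplus> cobound T s i y V = x V"
        using y(1) by (simp add: minus_eq a_assoc l_neg)
      then show ?thesis
        using cls_eq[OF V, of "cobound T s i y V" "x V \<ominus> cobound T s i y V"] y that by simp
    qed
    then have "z = coset_family (Suc i) (cobound T s i y)"
      by (auto simp: x(2) coset_family_def fun_eq_iff restrict_def)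
    then show "z \<in> ?B" using y(1) by blast
  qed
  have diff: "\<exists>c\<in>?B. ?add c b' = b" if "b \<in> ?B" "b' \<in> ?B" for b b'
  proof -
    from that obtain y y' where y: "y \<in> ?A" "y' \<in> ?A" "b = coset_family (Suc i) (cobound T s i y)"
      "b' = coset_family (Suc i) (cobound T s i y')" by auto
    let ?c = "\<lambda>U. y U \<ominus> y' U"
    have A: "?c \<in> ?A" using y by auto
    have "cobound T s i (\<lambda>U. ?c U \<oplus> y' U) V = cobound T s i y V" for V
      using y by (intro cobound_cong) (auto simp: Pi_iff minus_eq a_assoc l_neg)
    then have "cobound T s i ?c V \<oplus> cobound T s i y' V = cobound T s i y V" for V
      using A y by (simp add: cobound_add)
    then have "?add (coset_family (Suc i) (cobound T s i ?c)) b' = b"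
      using y A by (simp add: coset_family_add)
    then show ?thesis using A by blast
  qed
  have add: "?add b b' \<in> ?B" if "b \<in> ?B" "b' \<in> ?B" for b b'
  proof -
    from that obtain y y' where y: "y \<in> ?A" "y' \<in> ?A" "b = coset_family (Suc i) (cobound T s i y)"
      "b' = coset_family (Suc i) (cobound T s i y')" by auto
    have "?add b b' = coset_family (Suc i) (cobound T s i (\<lambda>U. y U \<oplus> y' U))"
      using y by (simp add: coset_family_add) (simp add: cobound_add coset_family_def)
    moreover have "(\<lambda>U. y U \<oplus> y' U) \<in> ?A" using y by auto
    ultimately show ?thesis by blast
  qed
  have coset: "(\<Union>b\<in>?B. {?add b z}) = ?B" if "z \<in> ?Z" for z
  proof (intro equalityI subsetI)
    have z: "z \<in> ?B" using ZB that by (rule subsetD)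
    show "b \<in> ?B" if "b \<in> (\<Union>b\<in>?B. {?add b z})" for b
      using that add[OF _ z] by (elim UN_E) (simp only: singleton_iff)
    show "b \<in> (\<Union>b\<in>?B. {?add b z})" if "b \<in> ?B" for b
      using diff[OF that z] by (simp only: UN_iff singleton_iff) metis
  qed
  have zero: "coset_family (Suc i) (\<lambda>_. \<zero>) \<in> ?Z"
  proof -
    have "cobound T s (Suc i) (\<lambda>_. \<zero>) V = \<zero>" for V
      by (simp add: cobound_def)
    moreover have "\<zero> \<in> ideal_sum T J V" if "V \<subseteq> {1..s}" for V
      using ideal_sum_is_ideal[OF that] by (simp add: ideal.axioms(1) additive_subgroup.zero_closed)
    ultimately show ?thesis by (auto simp: G_cocycles_eq subsets_of_card_def)
  qed
  have "(\<Union>z\<in>?Z. {\<Union>b\<in>?B. {?add b z}}) = (\<lambda>z. \<Union>b\<in>?B. {?add b z}) ` ?Z"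
    by (rule UNION_singleton_eq_range)
  also have "\<dots> = (\<lambda>z. ?B) ` ?Z" by (intro image_cong refl coset)
  also have "\<dots> = {?B}" by (rule image_constant[OF zero])
  finally have "(\<Union>z\<in>?Z. {\<Union>b\<in>?B. {?add b z}}) = {?B}" .
  then show ?thesis
    by (simp add: H_pos_def quot_module_def A_RCOSETS_def' a_r_coset_def' B)
qed

lemma ideal_sum_singleton:
  assumes "k \<in> {1..s}"
  shows "ideal_sum T J {k} = J k"
proof -
  interpret ideal "J k" T by (rule J_ideal[OF assms])
  have fin: "finsum T f {k} = f k" if "f k \<in> J k" for f
    using that a_subset by (subst finsum_insert) auto
  have "ideal_sum T J {k} = {finsum T f {k} | f. f k \<in> J k}"
    by (simp add: ideal_sum_def Pi_iff)
  also have "\<dots> = {f k | f. f k \<in> J k}"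
    using fin by (intro Collect_cong ex_cong1) auto
  also have "\<dots> = J k" by (auto intro: exI[of _ "\<lambda>_. _"])
  finally show ?thesis .
qed

text \<open>The component of the first differential at \<open>{k}\<close> is the residue class map to \<open>T/J_k\<close>, so its
  kernel consists of the elements lying in every \<open>J_k\<close>. For \<open>s = 0\<close> the intersection would be the
  whole type instead of the carrier.\<close>

lemma H_zero_eq:
  assumes "s \<ge> 1"
  shows "carrier (H_zero T J s) = G_zero_embed T J ` (\<Inter>k\<in>{1..s}. J k)"
proof -
  have one: "subsets_of_card s (Suc 0) = (\<lambda>k. {k}) ` {1..s}"
    by (auto simp: subsets_of_card_def card_1_singleton_iff)
  have cob: "cobound T s 0 x V = x {}" if "x {} \<in> carrier T" for x V
    using that by (simp add: cobound_def subsets_of_card_0 incidence_def)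
  have sub: "x \<in> carrier T" if "\<And>k. k \<in> {1..s} \<Longrightarrow> x \<in> J k" for x
    using that[of 1] J_ideal[of 1] assms
    by (auto dest!: ideal.axioms(1) additive_subgroup.a_subset)
  have emb: "coset_family 0 x = G_zero_embed T J (x {})" for x
    unfolding coset_family_def G_zero_embed_def subsets_of_card_0 by (rule restrict_ext) simp
  have "carrier (H_zero T J s) = coset_family 0 `
     {x \<in> {{} :: nat set} \<rightarrow> carrier T. \<forall>k\<in>{1..s}. x {} \<in> J k}"
    by (simp add: H_zero_def G_cocycles_eq one ideal_sum_singleton cob subsets_of_card_0 Pi_iff cong: conj_cong)
  also have "\<dots> = G_zero_embed T J ` (\<lambda>x. x {}) ` {x \<in> {{} :: nat set} \<rightarrow> carrier T. \<forall>k\<in>{1..s}. x {} \<in> J k}"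
    by (simp add: image_image emb)
  also have "(\<lambda>x. x {}) ` {x \<in> {{} :: nat set} \<rightarrow> carrier T. \<forall>k\<in>{1..s}. x {} \<in> J k} = (\<Inter>k\<in>{1..s}. J k)"
  proof (intro equalityI subsetI)
    fix a assume "a \<in> (\<Inter>k\<in>{1..s}. J k)"
    then show "a \<in> (\<lambda>x. x {}) ` {x \<in> {{} :: nat set} \<rightarrow> carrier T. \<forall>k\<in>{1..s}. x {} \<in> J k}"
      using sub by (intro image_eqI[of _ _ "\<lambda>_. a"]) auto
  qed auto
  finally show ?thesis .
qed

end

section \<open>Contracting the simplex\<close>

text \<open>The same signs as those of \<open>incidence\<close>, but in the ring in which the coefficients of
  polynomials live.\<close>

definition inc_sign :: "nat set \<Rightarrow> nat set \<Rightarrow> 'r::comm_ring_1" where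
  "inc_sign U V = (if U \<subseteq> V then (-1) ^ card {j \<in> U. j < the_elem (V - U)} else 0)"

text \<open>The subsets of \<open>V\<close> with one element less are the faces \<open>V - {k}\<close>, and \<open>k\<close> itself does not count
  among the elements below \<open>k\<close>: this is the usual simplicial coboundary formula.\<close>

lemma sum_inc_sign:
  fixes c :: "nat set \<Rightarrow> 'r::comm_ring_1"
  assumes V: "V \<in> subsets_of_card s (Suc i)"
  shows "(\<Sum>U\<in>subsets_of_card s i. inc_sign U V * c U)
       = (\<Sum>k\<in>V. (-1) ^ card {j \<in> V. j < k} * c (V - {k}))"
proof -
  have fin: "finite V" and card: "card V = Suc i" and sub: "V \<subseteq> {1..s}"
    using V by (auto simp: subsets_of_card_def intro: finite_subset)
  have "(\<Sum>U\<in>subsets_of_card s i. inc_sign U V * c U)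
      = (\<Sum>U\<in>(\<lambda>k. V - {k}) ` V. inc_sign U V * c U)"
  proof (rule sum.mono_neutral_right)
    show "(\<lambda>k. V - {k}) ` V \<subseteq> subsets_of_card s i"
      using sub fin card by (auto simp: subsets_of_card_def)
    show "\<forall>U\<in>subsets_of_card s i - (\<lambda>k. V - {k}) ` V. inc_sign U V * c U = 0"
    proof
      fix U assume U: "U \<in> subsets_of_card s i - (\<lambda>k. V - {k}) ` V"
      have "\<not> U \<subseteq> V"
      proof
        assume UV: "U \<subseteq> V"
        then have "card (V - U) = 1"
          using U card fin by (simp add: card_Diff_subset finite_subset subsets_of_card_def)
        then obtain k where "V - U = {k}" by (auto simp: card_1_singleton_iff)
        then have "k \<in> V" "U = V - {k}" using UV by auto
        then show False using U by blast
      qed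
      then show "inc_sign U V * c U = 0" by (simp add: inc_sign_def)
    qed
  qed simp
  also have "\<dots> = (\<Sum>k\<in>V. inc_sign (V - {k}) V * c (V - {k}))"
    by (subst sum.reindex) (auto simp: inj_on_def)
  also have "\<dots> = (\<Sum>k\<in>V. (-1) ^ card {j \<in> V. j < k} * c (V - {k}))"
  proof (rule sum.cong)
    fix k assume k: "k \<in> V"
    have "{j \<in> V - {k}. j < k} = {j \<in> V. j < k}" by auto
    moreover have "V - (V - {k}) = {k}" using k by auto
    ultimately show "inc_sign (V - {k}) V * c (V - {k}) = (-1) ^ card {j \<in> V. j < k} * c (V - {k})"
      by (simp add: inc_sign_def)
  qed simp
  finally show ?thesis .
qed

text \<open>The homotopy formula for coning off the vertex \<open>a = Min A\<close>. If \<open>a \<in> V\<close>, only the face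
  \<open>V - {a}\<close> contributes, and its sign is positive because \<open>a\<close> is minimal. If \<open>a \<notin> V\<close>, the cocycle
  condition at \<open>insert a V\<close> expresses \<open>c V\<close> by the values of \<open>c\<close> on the other faces; the signs agree because
  inserting the minimal vertex shifts each position by one.\<close>

lemma simplex_contraction:
  fixes c :: "nat set \<Rightarrow> 'r::comm_ring_1"
  assumes A: "A \<subseteq> {1..s}" and V: "V \<in> subsets_of_card s (Suc i)" "V \<subseteq> A"
    and cocycle: "\<And>W. W \<in> subsets_of_card s (Suc (Suc i)) \<Longrightarrow> W \<subseteq> A \<Longrightarrow>
        (\<Sum>U\<in>subsets_of_card s (Suc i). inc_sign U W * c U) = 0"
  shows "(\<Sum>U\<in>subsets_of_card s i. inc_sign U V * (if Min A \<in> U then 0 else c (insert (Min A) U)))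
       = c V"
proof -
  define a where "a = Min A"
  have fin: "finite V" "finite A" and card: "card V = Suc i"
    using A V by (auto simp: subsets_of_card_def intro: finite_subset)
  have "A \<noteq> {}" using V(2) card by auto
  then have aA: "a \<in> A" and le: "\<And>k. k \<in> A \<Longrightarrow> a \<le> k"
    using fin by (auto simp: a_def)
  have "(\<Sum>k\<in>V. (-1) ^ card {j \<in> V. j < k} * (if a \<in> V - {k} then 0 else c (insert a (V - {k}))))
      = c V"
  proof (cases "a \<in> V")
    case True
    have z: "{j \<in> V. j < a} = {}" using le V(2) by (auto simp: not_less)
    have "(\<Sum>k\<in>V. (-1) ^ card {j \<in> V. j < k} * (if a \<in> V - {k} then 0 else c (insert a (V - {k}))))
        = (\<Sum>k\<in>{a}. (-1) ^ card {j \<in> V. j < k} * (if a \<in> V - {k} then 0 else c (insert a (V - {k}))))"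
      using True fin by (intro sum.mono_neutral_right) auto
    also have "(\<Sum>k\<in>{a}. (-1) ^ card {j \<in> V. j < k} * (if a \<in> V - {k} then 0 else c (insert a (V - {k}))))
        = c V"
      using True by (simp add: insert_absorb z)
    finally show ?thesis .
  next
    case False
    let ?W = "insert a V"
    have W: "?W \<in> subsets_of_card s (Suc (Suc i))"
      using False V(1) fin aA A by (auto simp: subsets_of_card_def)
    have "0 = (\<Sum>k\<in>?W. (-1) ^ card {j \<in> ?W. j < k} * c (?W - {k}))"
      using cocycle[OF W] aA V(2) by (simp add: sum_inc_sign[OF W])
    also have "\<dots> = (-1) ^ card {j \<in> ?W. j < a} * c (?W - {a})
        + (\<Sum>k\<in>V. (-1) ^ card {j \<in> ?W. j < k} * c (?W - {k}))"
      using False fin by simp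
    also have "{j \<in> ?W. j < a} = {}" using le V(2) by (auto simp: not_less)
    also have "(\<Sum>k\<in>V. (-1) ^ card {j \<in> ?W. j < k} * c (?W - {k}))
        = (\<Sum>k\<in>V. - ((-1) ^ card {j \<in> V. j < k} *
             (if a \<in> V - {k} then 0 else c (insert a (V - {k})))))"
    proof (rule sum.cong)
      fix k assume k: "k \<in> V"
      then have "a < k" using False le[of k] V(2) by (metis in_mono le_neq_implies_less)
      then have "{j \<in> ?W. j < k} = insert a {j \<in> V. j < k}" "?W - {k} = insert a (V - {k})"
        by auto
      then show "(-1) ^ card {j \<in> ?W. j < k} * c (?W - {k})
        = - ((-1) ^ card {j \<in> V. j < k} * (if a \<in> V - {k} then 0 else c (insert a (V - {k}))))"
        using False fin by simp
    qed simp
    finally show ?thesis using False by (simp add: sum_negf algebra_simps)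
  qed
  then show ?thesis unfolding sum_inc_sign[OF V(1)] a_def .
qed

section \<open>Monomial ideals\<close>

lemma mem_mpoly_ring_iff:
  "p \<in> carrier (mpoly_ring n) \<longleftrightarrow> (\<forall>m\<in>Poly_Mapping.keys p. Poly_Mapping.keys m \<subseteq> {1..n})"
  by (simp add: mpoly_ring_def)

lemma mpoly_ring_ops [simp]:
  "monoid.mult (mpoly_ring n) = (*)" "\<one>\<^bsub>mpoly_ring n\<^esub> = 1"
  "\<zero>\<^bsub>mpoly_ring n\<^esub> = 0" "add (mpoly_ring n) = (+)"
  by (simp_all add: mpoly_ring_def)

lemma mpoly_ring_cring: "cring (mpoly_ring n :: ('k::field) mpoly ring)"
proof (rule cringI)
  show "abelian_group (mpoly_ring n :: 'k mpoly ring)"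
  proof (rule abelian_groupI)
    fix x y :: "'k mpoly" assume "x \<in> carrier (mpoly_ring n)" "y \<in> carrier (mpoly_ring n)"
    then show "x \<oplus>\<^bsub>mpoly_ring n\<^esub> y \<in> carrier (mpoly_ring n)"
      using keys_add[of x y] by (auto simp: mem_mpoly_ring_iff)
  next
    fix x :: "'k mpoly" assume "x \<in> carrier (mpoly_ring n)"
    then show "\<exists>y\<in>carrier (mpoly_ring n). y \<oplus>\<^bsub>mpoly_ring n\<^esub> x = \<zero>\<^bsub>mpoly_ring n\<^esub>"
      by (intro bexI[of _ "- x"]) (auto simp: mem_mpoly_ring_iff)
  qed (auto simp: add_ac mem_mpoly_ring_iff)
  show "comm_monoid (mpoly_ring n :: 'k mpoly ring)"
  proof (rule comm_monoidI)
    fix x y :: "'k mpoly" assume xy: "x \<in> carrier (mpoly_ring n)" "y \<in> carrier (mpoly_ring n)"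
    have "Poly_Mapping.keys m \<subseteq> {1..n}" if m: "m \<in> Poly_Mapping.keys (x * y)" for m
    proof -
      obtain a b where "m = a + b" "a \<in> Poly_Mapping.keys x" "b \<in> Poly_Mapping.keys y"
        using keys_mult[of x y] m by auto
      then show ?thesis using xy keys_add[of a b] by (force simp: mem_mpoly_ring_iff)
    qed
    then show "x \<otimes>\<^bsub>mpoly_ring n\<^esub> y \<in> carrier (mpoly_ring n)" by (simp add: mem_mpoly_ring_iff)
  qed (auto simp: mult_ac mem_mpoly_ring_iff)
qed (auto simp: distrib_right)

lemma mpoly_ring_a_inv:
  assumes "p \<in> carrier (mpoly_ring n)"
  shows "\<ominus>\<^bsub>mpoly_ring n\<^esub> p = - p"
proof -
  interpret cring "mpoly_ring n :: 'a mpoly ring" by (rule mpoly_ring_cring)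
  show ?thesis
    using assms by (intro minus_equality) (auto simp: mem_mpoly_ring_iff)
qed

lemma mpoly_ring_minus:
  assumes "p \<in> carrier (mpoly_ring n)" "q \<in> carrier (mpoly_ring n)"
  shows "p \<ominus>\<^bsub>mpoly_ring n\<^esub> q = p - q"
  using assms(2) by (simp add: a_minus_def mpoly_ring_a_inv)

lemma mpoly_ring_pow: "p [^]\<^bsub>mpoly_ring n\<^esub> (l::nat) = p ^ l"
  by (induction l) (simp_all add: mult.commute)

lemma finsum_mpoly_ring:
  fixes f :: "'i \<Rightarrow> ('k::field) mpoly"
  assumes "finite A" "f \<in> A \<rightarrow> carrier (mpoly_ring n)"
  shows "finsum (mpoly_ring n) f A = sum f A"
proof -
  interpret cring "mpoly_ring n :: 'k mpoly ring" by (rule mpoly_ring_cring)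
  show ?thesis using assms
    by (induction A rule: finite_induct) (simp_all add: Pi_iff)
qed

text \<open>The linear span of the monomials in \<open>x_1, \<dots>, x_n\<close> whose exponents lie in \<open>E\<close>.\<close>

definition exponent_span :: "nat \<Rightarrow> (nat \<Rightarrow>\<^sub>0 nat) set \<Rightarrow> ('k::field) mpoly set" where
  "exponent_span n E = {p \<in> carrier (mpoly_ring n). Poly_Mapping.keys p \<subseteq> E}"

lemma mpoly_mem_additive:
  fixes p :: "('a \<Rightarrow>\<^sub>0 'k::comm_monoid_add)"
  assumes "0 \<in> A" "\<And>p q. p \<in> A \<Longrightarrow> q \<in> A \<Longrightarrow> p + q \<in> A"
    and "\<And>m. m \<in> Poly_Mapping.keys p \<Longrightarrow> Poly_Mapping.single m (Poly_Mapping.lookup p m) \<in> A"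
  shows "p \<in> A"
proof -
  have "p = (\<Sum>m\<in>Poly_Mapping.keys p. Poly_Mapping.single m (Poly_Mapping.lookup p m))"
    by (rule poly_mapping_eqI) (auto simp: lookup_sum lookup_single when_def in_keys_iff)
  moreover have "(\<Sum>m\<in>M. Poly_Mapping.single m (Poly_Mapping.lookup p m)) \<in> A"
    if "M \<subseteq> Poly_Mapping.keys p" for M
    using finite_subset[OF that finite_keys] that
    by (induction M rule: finite_induct) (auto intro: assms)
  ultimately show ?thesis by (metis order_refl)
qed

text \<open>The exponents divisible by the exponent of a generator span an ideal, since the exponents of
  a product are sums of exponents of the factors. This ideal contains the generators and is generated
  by them.\<close>

lemma monomial_ideal_exponent_span:
  assumes "monomial_ideal n (I :: ('k::field) mpoly set)"
  shows "ideal I (mpoly_ring n) \<and> (\<exists>E. I = exponent_span n E)"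
proof -
  interpret cring "mpoly_ring n :: 'k mpoly ring" by (rule mpoly_ring_cring)
  obtain M where M: "M \<subseteq> monomials n" "I = Idl\<^bsub>mpoly_ring n\<^esub> M"
    using assms by (auto simp: monomial_ideal_def)
  have Mc: "M \<subseteq> carrier (mpoly_ring n)" using M(1) by (auto simp: monomials_def mem_mpoly_ring_iff)
  interpret I: ideal I "mpoly_ring n" unfolding M(2) by (rule genideal_ideal[OF Mc])
  \<comment> \<open>the exponents divisible by that of a generator\<close>
  define E where
    "E = {e + m | e m. Poly_Mapping.single e (1::'k) \<in> M \<and> Poly_Mapping.keys m \<subseteq> {1..n}}"
  have "ideal (exponent_span n E :: 'k mpoly set) (mpoly_ring n)"
  proof (rule idealI[OF ring_axioms])
    show "subgroup (exponent_span n E :: 'k mpoly set) (add_monoid (mpoly_ring n))"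
    proof (rule add.subgroupI)
      fix p q :: "'k mpoly" assume pq: "p \<in> exponent_span n E" "q \<in> exponent_span n E"
      then have "p \<oplus>\<^bsub>mpoly_ring n\<^esub> q \<in> carrier (mpoly_ring n)"
        by (intro a_closed) (simp_all add: exponent_span_def)
      then show "p \<oplus>\<^bsub>mpoly_ring n\<^esub> q \<in> exponent_span n E"
        using pq keys_add[of p q] by (auto simp: exponent_span_def)
    qed (auto simp: exponent_span_def mpoly_ring_a_inv mem_mpoly_ring_iff intro: exI[of _ 0])
    have "x * a \<in> exponent_span n E"
      if a: "a \<in> exponent_span n E" and x: "x \<in> carrier (mpoly_ring n)" for a x :: "'k mpoly"
    proof -
      have "x \<otimes>\<^bsub>mpoly_ring n\<^esub> a \<in> carrier (mpoly_ring n)"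
        using a x by (intro m_closed) (simp_all add: exponent_span_def)
      moreover have "k \<in> E" if k: "k \<in> Poly_Mapping.keys (x * a)" for k
      proof -
        obtain u v where uv: "k = u + v" "u \<in> Poly_Mapping.keys x" "v \<in> Poly_Mapping.keys a"
          using keys_mult[of x a] k by auto
        then obtain e m where em: "v = e + m" "Poly_Mapping.single e (1::'k) \<in> M"
            "Poly_Mapping.keys m \<subseteq> {1..n}"
          using a by (auto simp: exponent_span_def E_def)
        have "Poly_Mapping.keys (u + m) \<subseteq> {1..n}"
          using keys_add[of u m] em(3) x uv(2) by (force simp: mem_mpoly_ring_iff)
        moreover have "k = e + (u + m)" by (simp add: uv em add_ac)
        ultimately show ?thesis unfolding E_def using em(2) by blast
      qed
      ultimately show ?thesis by (auto simp: exponent_span_def)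
    qed
    then show "\<And>a x :: 'k mpoly. \<lbrakk>a \<in> exponent_span n E; x \<in> carrier (mpoly_ring n)\<rbrakk>
        \<Longrightarrow> x \<otimes>\<^bsub>mpoly_ring n\<^esub> a \<in> exponent_span n E"
      and "\<And>a x :: 'k mpoly. \<lbrakk>a \<in> exponent_span n E; x \<in> carrier (mpoly_ring n)\<rbrakk>
        \<Longrightarrow> a \<otimes>\<^bsub>mpoly_ring n\<^esub> x \<in> exponent_span n E"
      by (simp_all only: mpoly_ring_ops mult.commute)
  qed
  moreover have "M \<subseteq> exponent_span n E"
  proof
    fix p assume p: "p \<in> M"
    then obtain e where e: "p = Poly_Mapping.single e 1" using M(1) by (auto simp: monomials_def)
    have "e + 0 \<in> E" unfolding E_def using p e by (intro CollectI exI[of _ e] exI[of _ 0]) auto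
    moreover have "p \<in> carrier (mpoly_ring n)" using p Mc by blast
    ultimately show "p \<in> exponent_span n E" by (simp add: e exponent_span_def)
  qed
  ultimately have "I \<subseteq> exponent_span n E" unfolding M(2) by (rule genideal_minimal)
  moreover have "exponent_span n E \<subseteq> I"
  proof
    fix p :: "'k mpoly" assume p: "p \<in> exponent_span n E"
    show "p \<in> I"
    proof (rule mpoly_mem_additive)
      show "0 \<in> I" using I.zero_closed by simp
      show "p + q \<in> I" if "p \<in> I" "q \<in> I" for p q using I.a_closed[OF that] by simp
      fix k assume k: "k \<in> Poly_Mapping.keys p"
      then obtain e m where em: "k = e + m" "Poly_Mapping.single e (1::'k) \<in> M"
          "Poly_Mapping.keys m \<subseteq> {1..n}"
        using p by (auto simp: exponent_span_def E_def)
      have "Poly_Mapping.single e 1 \<in> I" unfolding M(2) using genideal_self[OF Mc] em(2) by blast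
      then have "Poly_Mapping.single m (Poly_Mapping.lookup p k) * Poly_Mapping.single e 1 \<in> I"
        using I.I_l_closed[of "Poly_Mapping.single e 1" "Poly_Mapping.single m (Poly_Mapping.lookup p k)"] em(3)
        by (simp add: mem_mpoly_ring_iff)
      then show "Poly_Mapping.single k (Poly_Mapping.lookup p k) \<in> I"
        by (simp add: em mult_single add.commute)
    qed
  qed
  ultimately show ?thesis using I.ideal_axioms by blast
qed

section \<open>Exactness\<close>

text \<open>With the projection onto \<open>T\<close> as \<open>h\<close>, differentials can be computed on polynomials.\<close>

lemma (in ring_hom_cring) hom_cobound:
  assumes "f \<in> subsets_of_card s i \<rightarrow> carrier R"
  shows "h (cobound R s i f V) = cobound S s i (\<lambda>U. h (f U)) V"
proof -
  have "h (incidence R U V) = incidence S U V" for U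
    by (simp add: incidence_def)
  then show ?thesis
    unfolding cobound_def using assms
    by (subst hom_finsum) (auto simp: o_def Pi_iff incidence_def intro!: S.finsum_cong')
qed

lemma lookup_cobound_mpoly_ring:
  fixes f :: "nat set \<Rightarrow> ('k::field) mpoly"
  assumes "f \<in> subsets_of_card s i \<rightarrow> carrier (mpoly_ring n)"
  shows "Poly_Mapping.lookup (cobound (mpoly_ring n) s i f V) m =
    (\<Sum>U\<in>subsets_of_card s i. inc_sign U V * Poly_Mapping.lookup (f U) m)"
proof -
  interpret cring "mpoly_ring n :: 'k mpoly ring" by (rule mpoly_ring_cring)
  have pow: "Poly_Mapping.lookup ((-1) ^ l * p) m = (-1) ^ l * Poly_Mapping.lookup p m"
    for l and p :: "'k mpoly" by (cases "even l") simp_all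
  have "\<one>\<^bsub>mpoly_ring n\<^esub> \<in> carrier (mpoly_ring n :: 'k mpoly ring)" by (rule one_closed)
  then have inc: "incidence (mpoly_ring n :: 'k mpoly ring) U V =
     (if U \<subseteq> V then (-1) ^ card {j \<in> U. j < the_elem (V - U)} else 0)" for U
    by (simp add: incidence_def mpoly_ring_a_inv mpoly_ring_pow)
  have closed: "incidence (mpoly_ring n) U V \<in> carrier (mpoly_ring n :: 'k mpoly ring)" for U
    by (simp add: incidence_def del: mpoly_ring_ops)
  have "cobound (mpoly_ring n) s i f V
     = (\<Sum>U\<in>subsets_of_card s i. incidence (mpoly_ring n) U V * f U)"
  proof -
    have "(\<lambda>U. incidence (mpoly_ring n) U V \<otimes>\<^bsub>mpoly_ring n\<^esub> f U) \<in> subsets_of_card s i \<rightarrow> carrier (mpoly_ring n)"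
      using assms closed by (auto simp del: mpoly_ring_ops intro!: m_closed)
    from finsum_mpoly_ring[OF _ this] show ?thesis by (simp add: cobound_def)
  qed
  then show ?thesis by (simp add: lookup_sum inc inc_sign_def pow if_distrib if_distribR cong: if_cong)
qed


text \<open>The coning operator applied at each exponent \<open>m\<close> with its own vertex \<open>Min (A m)\<close>. Sorting the
  exponents by their vertex gives a finite sum of truncations of the \<open>f (insert k U)\<close>, so the result is a
  polynomial.\<close>

lemma homotopy_polynomial:
  fixes f :: "nat set \<Rightarrow> ('k::field) mpoly"
  assumes "\<And>U. f U \<in> carrier (mpoly_ring n)"
    and "\<And>m. A m \<subseteq> {1..s}"
  obtains b where "\<And>U. b U \<in> carrier (mpoly_ring n)"
    and "\<And>U m. A m \<noteq> {} \<Longrightarrow> Poly_Mapping.lookup (b U) m =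
           (if Min (A m) \<in> U then 0 else Poly_Mapping.lookup (f (insert (Min (A m)) U)) m)"
proof
  define b where "b = (\<lambda>U. \<Sum>k\<in>{1..s} - U.
     Poly_Mapping.mapp (\<lambda>m c. if k = Min (A m) then c else 0) (f (insert k U)))"
  show "b U \<in> carrier (mpoly_ring n)" for U
  proof -
    have "Poly_Mapping.keys (b U) \<subseteq> (\<Union>k\<in>{1..s} - U. Poly_Mapping.keys
        (Poly_Mapping.mapp (\<lambda>m c. if k = Min (A m) then c else 0) (f (insert k U))))"
      unfolding b_def by (rule keys_sum)
    also have "\<dots> \<subseteq> (\<Union>k\<in>{1..s} - U. Poly_Mapping.keys (f (insert k U)))"
      by (intro UN_mono order_refl keys_mapp_subset)
    finally have "\<exists>k. m \<in> Poly_Mapping.keys (f (insert k U))" if "m \<in> Poly_Mapping.keys (b U)" for m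
      using that by blast
    then show ?thesis using assms(1) unfolding mem_mpoly_ring_iff by meson
  qed
  fix U m assume "A m \<noteq> {}"
  then have min: "Min (A m) \<in> {1..s}"
    using subsetD[OF assms(2) Min_in[OF finite_subset[OF assms(2) finite_atLeastAtMost]]] by simp
  have "Poly_Mapping.lookup (b U) m = (\<Sum>k\<in>{1..s} - U.
     if k = Min (A m) then Poly_Mapping.lookup (f (insert k U)) m else 0)"
    unfolding b_def lookup_sum
    by (rule sum.cong) (auto simp: lookup_mapp when_def in_keys_iff)
  then show "Poly_Mapping.lookup (b U) m =
      (if Min (A m) \<in> U then 0 else Poly_Mapping.lookup (f (insert (Min (A m)) U)) m)"
    using min by (simp add: sum.delta)
qed

text \<open>The situation of the theorem, together with sets of exponents whose monomials span the
  monomial ideals.\<close>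

locale monomial_family =
  fixes n s :: nat
    and I :: "('k::field) mpoly set"
    and Is :: "nat \<Rightarrow> 'k mpoly set"
    and E0 :: "(nat \<Rightarrow>\<^sub>0 nat) set"
    and E :: "nat \<Rightarrow> (nat \<Rightarrow>\<^sub>0 nat) set"
  assumes I_ideal: "ideal I (mpoly_ring n)" and I_eq: "I = exponent_span n E0"
    and Is_ideal: "k \<in> {1..s} \<Longrightarrow> ideal (Is k) (mpoly_ring n)"
    and Is_eq: "k \<in> {1..s} \<Longrightarrow> Is k = exponent_span n (E k)"
begin

abbreviation S :: "'k mpoly ring" where "S \<equiv> mpoly_ring n"
abbreviation T :: "'k mpoly set ring" where "T \<equiv> S Quot I"
abbreviation proj :: "'k mpoly \<Rightarrow> 'k mpoly set" where "proj f \<equiv> I +>\<^bsub>S\<^esub> f"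
definition J :: "nat \<Rightarrow> 'k mpoly set set" where
  "J k = proj ` (set_add S (Is k) I)"

sublocale S: cring S by (rule mpoly_ring_cring)

sublocale I: ideal I S by (rule I_ideal)

sublocale T: cring T by (rule I.quotient_is_cring) (rule S.is_cring)

sublocale proj: ring_hom_cring S T proj
  by (rule I.rcos_ring_hom_cring) (rule S.is_cring)

sublocale J: ideal_family T J s
proof (intro ideal_family.intro ideal_family_axioms.intro)
  show "cring T" by (rule T.is_cring)
  show "ideal (J k) T" if "k \<in> {1..s}" for k
    unfolding J_def
    by (intro S.ring_ideal_imp_quot_ideal S.add_ideals I_ideal Is_ideal that)
qed

lemma carrier_T: "carrier T = proj ` carrier S"
  by (auto simp: FactRing_def A_RCOSETS_def')

lemma proj_eq_iff:
  assumes "p \<in> carrier S" "q \<in> carrier S"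
  shows "proj p = proj q \<longleftrightarrow> p - q \<in> I"
  using S.quotient_eq_iff_same_a_r_cos[OF I_ideal assms] assms
  by (simp add: mpoly_ring_minus)

text \<open>This is where monomiality enters: a polynomial in a sum of ideals spanned by monomials can be
  split into its terms, each of which lies in one of the ideals.\<close>

lemma proj_mem_ideal_sum_iff:
  assumes U: "U \<subseteq> {1..s}" and p: "p \<in> carrier S"
  shows "proj p \<in> ideal_sum T J U \<longleftrightarrow> Poly_Mapping.keys p \<subseteq> E0 \<union> (\<Union>k\<in>U. E k)"
proof
  have fin: "finite U" using U by (rule finite_subset) simp
  assume "proj p \<in> ideal_sum T J U"
  then obtain g where g: "g \<in> (\<Pi> k\<in>U. J k)" "proj p = finsum T g U"
    by (auto simp: ideal_sum_def)
  have "\<forall>k\<in>U. \<exists>q. q \<in> carrier S \<and> Poly_Mapping.keys q \<subseteq> E0 \<union> E k \<and> g k = proj q"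
  proof
    fix k assume k: "k \<in> U"
    then have ks: "k \<in> {1..s}" using U by blast
    have "g k \<in> J k" using g k by blast
    then obtain a b where ab: "a \<in> Is k" "b \<in> I" "g k = proj (a + b)"
      unfolding J_def set_add_def' by auto
    interpret Ik: ideal "Is k" S by (rule Is_ideal[OF ks])
    have "a \<oplus>\<^bsub>S\<^esub> b \<in> carrier S"
      using Ik.a_Hcarr[OF ab(1)] I.a_Hcarr[OF ab(2)] by (rule S.a_closed)
    then have c: "a + b \<in> carrier S" by (simp only: mpoly_ring_ops)
    have "Poly_Mapping.keys a \<subseteq> E k" "Poly_Mapping.keys b \<subseteq> E0"
      using ab(1,2) unfolding Is_eq[OF ks] I_eq exponent_span_def by simp_all
    then have "Poly_Mapping.keys (a + b) \<subseteq> E0 \<union> E k"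
      using keys_add[of a b] by blast
    with c ab(3) show "\<exists>q. q \<in> carrier S \<and> Poly_Mapping.keys q \<subseteq> E0 \<union> E k \<and> g k = proj q"
      by (intro exI conjI)
  qed
  then obtain q where q: "\<forall>k\<in>U. q k \<in> carrier S \<and> Poly_Mapping.keys (q k) \<subseteq> E0 \<union> E k \<and> g k = proj (q k)"
    by metis
  have qc: "q \<in> U \<rightarrow> carrier S" using q by blast
  have "finsum T g U = (\<Oplus>\<^bsub>T\<^esub>k\<in>U. proj (q k))"
    using q qc by (intro T.finsum_cong') auto
  also have "\<dots> = proj (finsum S q U)" using proj.hom_finsum[OF qc] by (simp add: o_def)
  finally have "proj p = proj (finsum S q U)" using g(2) by simp
  moreover have "finsum S q U \<in> carrier S" using qc by (rule S.finsum_closed)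
  ultimately have "p - finsum S q U \<in> I" using p proj_eq_iff by blast
  then have "Poly_Mapping.keys (p - finsum S q U) \<subseteq> E0" unfolding I_eq exponent_span_def by blast
  moreover have "Poly_Mapping.keys (finsum S q U) \<subseteq> E0 \<union> (\<Union>k\<in>U. E k)"
    using keys_sum[of q U] q unfolding finsum_mpoly_ring[OF fin qc] by blast
  moreover have "Poly_Mapping.keys p \<subseteq>
      Poly_Mapping.keys (p - finsum S q U) \<union> Poly_Mapping.keys (finsum S q U)"
    using keys_add[of "p - finsum S q U" "finsum S q U"] by simp
  ultimately show "Poly_Mapping.keys p \<subseteq> E0 \<union> (\<Union>k\<in>U. E k)" by blast
next
  interpret JU: ideal "ideal_sum T J U" T by (rule J.ideal_sum_is_ideal[OF U])
  assume sub: "Poly_Mapping.keys p \<subseteq> E0 \<union> (\<Union>k\<in>U. E k)"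
  have "p \<in> {q \<in> carrier S. proj q \<in> ideal_sum T J U}"
  proof (rule mpoly_mem_additive)
    show "0 \<in> {q \<in> carrier S. proj q \<in> ideal_sum T J U}"
      using S.zero_closed JU.zero_closed proj.hom_zero by simp
    show "q + r \<in> {q \<in> carrier S. proj q \<in> ideal_sum T J U}"
      if "q \<in> {q \<in> carrier S. proj q \<in> ideal_sum T J U}"
        "r \<in> {q \<in> carrier S. proj q \<in> ideal_sum T J U}" for q r
    proof -
      have "q \<oplus>\<^bsub>S\<^esub> r \<in> carrier S" using that by (intro S.a_closed) blast+
      moreover have "proj (q \<oplus>\<^bsub>S\<^esub> r) \<in> ideal_sum T J U"
        using that JU.a_closed proj.hom_add by (simp del: mpoly_ring_ops)
      ultimately show ?thesis by simp
    qed
    fix m assume m: "m \<in> Poly_Mapping.keys p"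
    let ?q = "Poly_Mapping.single m (Poly_Mapping.lookup p m)"
    have keys: "Poly_Mapping.keys ?q \<subseteq> {m}" by simp
    then have "Poly_Mapping.keys ?q \<subseteq> Poly_Mapping.keys p" using m by blast
    then have qc: "?q \<in> carrier S" using p unfolding mem_mpoly_ring_iff by blast
    have "proj ?q \<in> ideal_sum T J U"
    proof (cases "m \<in> E0")
      case True
      then have "?q \<in> I"
        unfolding I_eq exponent_span_def using qc keys by blast
      then have "proj ?q = I" by (rule I.a_rcos_const)
      then have "proj ?q = \<zero>\<^bsub>T\<^esub>" by (simp only: FactRing_def ring_record_simps)
      then show ?thesis using JU.zero_closed by (simp only:)
    next
      case False
      then obtain k where k: "k \<in> U" "m \<in> E k" using sub m by blast
      then have ks: "k \<in> {1..s}" using U by blast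
      have "?q \<in> Is k"
        unfolding Is_eq[OF ks] exponent_span_def using qc keys k(2) by blast
      then have "?q \<oplus>\<^bsub>S\<^esub> \<zero>\<^bsub>S\<^esub> \<in> set_add S (Is k) I"
        unfolding set_add_def' using I.zero_closed by blast
      then have "proj ?q \<in> J k"
        unfolding J_def by (simp only: S.r_zero[OF qc] imageI)
      then show ?thesis
        using J.ideal_sum_singleton[OF ks] J.ideal_sum_mono[of "{k}" U] k(1) U by blast
    qed
    then show "?q \<in> {q \<in> carrier S. proj q \<in> ideal_sum T J U}" using qc by blast
  qed
  then show "proj p \<in> ideal_sum T J U" by blast
qed

text \<open>Apply the coning operator to polynomials \<open>f U\<close> representing the cocycle. It remains to compare
  coefficients at an exponent \<open>m\<close> that belongs to none of the ideals indexed by \<open>V\<close> nor to \<open>I\<close>, that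
  is, with \<open>V \<subseteq> A m\<close>. There the cocycle condition, which in general holds only modulo the ideals,
  holds exactly on all \<open>W \<subseteq> A m\<close>, and the contraction of the simplex on \<open>A m\<close> applies.\<close>

lemma cocycle_is_coboundary:
  assumes x: "x \<in> subsets_of_card s (Suc i) \<rightarrow> carrier T"
    and cocycle: "\<forall>W\<in>subsets_of_card s (Suc (Suc i)). cobound T s (Suc i) x W \<in> ideal_sum T J W"
  shows "\<exists>y \<in> subsets_of_card s i \<rightarrow> carrier T.
    \<forall>V\<in>subsets_of_card s (Suc i). x V \<ominus>\<^bsub>T\<^esub> cobound T s i y V \<in> ideal_sum T J V"
proof -
  have "\<exists>q. q \<in> carrier S \<and> (U \<in> subsets_of_card s (Suc i) \<longrightarrow> x U = proj q)" for U
  proof (cases "U \<in> subsets_of_card s (Suc i)")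
    case True
    then have "x U \<in> proj ` carrier S" using x carrier_T by blast
    then show ?thesis by blast
  next
    case False
    then show ?thesis using S.zero_closed by blast
  qed
  \<comment> \<open>The representatives are chosen for all index sets, so that no membership conditions remain.\<close>
  then obtain f where f: "f U \<in> carrier S" "U \<in> subsets_of_card s (Suc i) \<Longrightarrow> x U = proj (f U)" for U
    by metis
  define A where "A = (\<lambda>m. {k \<in> {1..s}. m \<notin> E k})"
  have A: "A m \<subseteq> {1..s}" for m by (auto simp: A_def)
  obtain b where b: "\<And>U. b U \<in> carrier S"
    "\<And>U m. A m \<noteq> {} \<Longrightarrow> Poly_Mapping.lookup (b U) m =
       (if Min (A m) \<in> U then 0 else Poly_Mapping.lookup (f (insert (Min (A m)) U)) m)"
    by (rule homotopy_polynomial[of f n A s, OF f(1) A]) (rule that)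
  have cobS: "cobound S s j g V \<in> carrier S" if "\<And>U. g U \<in> carrier S" for g j V
    using that by (intro S.cobound_closed funcsetI)
  have cob_x: "cobound T s (Suc i) x W = proj (cobound S s (Suc i) f W)" for W
  proof -
    have "cobound T s (Suc i) x W = cobound T s (Suc i) (\<lambda>U. proj (f U)) W"
      by (rule T.cobound_cong) (use f in \<open>auto intro: proj.hom_closed\<close>)
    also have "\<dots> = proj (cobound S s (Suc i) f W)"
      using f(1) by (intro proj.hom_cobound[symmetric]) blast
    finally show ?thesis .
  qed
  have diff: "x V \<ominus>\<^bsub>T\<^esub> cobound T s i (\<lambda>U. proj (b U)) V \<in> ideal_sum T J V"
    if V: "V \<in> subsets_of_card s (Suc i)" for V
  proof -
    have Vs: "V \<subseteq> {1..s}" using V by (simp add: subsets_of_card_def)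
    let ?d = "f V \<ominus>\<^bsub>S\<^esub> cobound S s i b V"
    have dc: "?d \<in> carrier S" using f(1) cobS[OF b(1)] by (rule S.minus_closed)
    have "x V \<ominus>\<^bsub>T\<^esub> cobound T s i (\<lambda>U. proj (b U)) V = proj ?d"
      using f(1) f(2)[OF V] cobS[where g = b and j = i and V = V, OF b(1)] proj.hom_cobound[where f = b and s = s and i = i and V = V] b(1)
      by (simp add: a_minus_def Pi_iff del: mpoly_ring_ops)
    moreover have "Poly_Mapping.keys ?d \<subseteq> E0 \<union> (\<Union>k\<in>V. E k)"
    proof (rule subsetI, rule ccontr)
      fix m assume m: "m \<in> Poly_Mapping.keys ?d" "m \<notin> E0 \<union> (\<Union>k\<in>V. E k)"
      have VA: "V \<subseteq> A m" using m(2) V by (auto simp: A_def subsets_of_card_def)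
      have "V \<noteq> {}" using V by (auto simp: subsets_of_card_def)
      then have ne: "A m \<noteq> {}" using VA by blast
      have coc: "(\<Sum>U\<in>subsets_of_card s (Suc i). inc_sign U W * Poly_Mapping.lookup (f U) m) = 0"
        if W: "W \<in> subsets_of_card s (Suc (Suc i))" "W \<subseteq> A m" for W
      proof -
        have Ws: "W \<subseteq> {1..s}" using W(1) by (simp add: subsets_of_card_def)
        have "proj (cobound S s (Suc i) f W) \<in> ideal_sum T J W"
          using bspec[OF cocycle W(1)] by (simp only: cob_x)
        then have "Poly_Mapping.keys (cobound S s (Suc i) f W) \<subseteq> E0 \<union> (\<Union>k\<in>W. E k)"
          by (rule iffD1[OF proj_mem_ideal_sum_iff[OF Ws cobS[where g = f, OF f(1)]]])
        then have "m \<notin> Poly_Mapping.keys (cobound S s (Suc i) f W)"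
          using m(2) W(2) by (auto simp: A_def)
        then show ?thesis
          using f(1) by (subst lookup_cobound_mpoly_ring[symmetric]) (simp_all add: Pi_iff in_keys_iff)
      qed
      have "Poly_Mapping.lookup (cobound S s i b V) m =
         (\<Sum>U\<in>subsets_of_card s i. inc_sign U V *
            (if Min (A m) \<in> U then 0 else Poly_Mapping.lookup (f (insert (Min (A m)) U)) m))"
        using b(1) by (subst lookup_cobound_mpoly_ring) (simp_all add: Pi_iff b(2)[OF ne])
      also have "\<dots> = Poly_Mapping.lookup (f V) m"
        by (rule simplex_contraction[OF A V VA coc])
      finally have "Poly_Mapping.lookup ?d m = 0"
        using f(1) cobS[OF b(1)] by (simp add: mpoly_ring_minus lookup_minus del: mpoly_ring_ops)
      then show False using m(1) by (simp add: in_keys_iff)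
    qed
    ultimately show ?thesis
      using proj_mem_ideal_sum_iff[OF Vs dc] by (simp only:)
  qed
  show ?thesis
  proof (intro bexI ballI)
    show "(\<lambda>U. proj (b U)) \<in> subsets_of_card s i \<rightarrow> carrier T"
      by (intro funcsetI proj.hom_closed b(1))
  qed (rule diff)
qed

end

theorem theorem1p1:
  fixes n s :: nat
    and I :: "('k::field) mpoly set"
    and Is :: "nat \<Rightarrow> 'k mpoly set"
    and S :: "'k mpoly ring"
    and T :: "'k mpoly set ring"
    and J :: "nat \<Rightarrow> 'k mpoly set set"
  assumes "S = mpoly_ring n"
    and "monomial_ideal n I"
    and "T = S Quot I"
    and "s \<ge> 1"
    and "\<forall>k\<in>{1..s}. monomial_ideal n (Is k)"
    and "J = (\<lambda>k. (\<lambda>f. I +>\<^bsub>S\<^esub> f) ` (Is k <+>\<^bsub>S\<^esub> I))"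
  shows "carrier (H_zero T J s) = G_zero_embed T J ` (\<Inter>k\<in>{1..s}. J k)
    \<and> (\<forall>i\<ge>1. carrier (H_pos T J s i) = {\<zero>\<^bsub>H_pos T J s i\<^esub>})"
proof -
  obtain E0 where E0: "I = exponent_span n E0"
    using monomial_ideal_exponent_span[OF assms(2)] by blast
  have "\<forall>k\<in>{1..s}. \<exists>E. Is k = exponent_span n E"
    using assms(5) monomial_ideal_exponent_span by blast
  then obtain E where E: "\<forall>k\<in>{1..s}. Is k = exponent_span n (E k)" by metis
  interpret M: monomial_family n s I Is E0 E
  proof (rule monomial_family.intro)
    show "ideal I (mpoly_ring n)" using monomial_ideal_exponent_span[OF assms(2)] by blast
    show "ideal (Is k) (mpoly_ring n)" if "k \<in> {1..s}" for k
      using monomial_ideal_exponent_span assms(5) that by blast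
  qed (use E0 E in blast)+
  have J: "J = M.J" unfolding assms(6) assms(1) by (rule ext) (simp only: M.J_def)
  have T: "T = M.T" unfolding assms(3) assms(1) ..
  have "carrier (H_pos T J s i) = {\<zero>\<^bsub>H_pos T J s i\<^esub>}" if i: "i \<ge> 1" for i
  proof -
    obtain j where j: "i = Suc j" using i by (cases i) simp_all
    show ?thesis
      unfolding J T j by (rule M.J.H_pos_trivial[OF M.cocycle_is_coboundary])
  qed
  moreover have "carrier (H_zero T J s) = G_zero_embed T J ` (\<Inter>k\<in>{1..s}. J k)"
    unfolding J T by (rule M.J.H_zero_eq[OF assms(4)])
  ultimately show ?thesis by simp
qed

end
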